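(* Let $k\in\{-1,1\}$, let $X$ be an $n\times n$ $(0,k)$-matrix, let $R=(R_1,\dots,R_n)$ and $S=(S_1,\dots,S_n)$ be vectors with entries in $\{0,\pm1\}$, and let $\mathcal R$ and $\mathcal S$ be the sets respectively containing the type $R_i$ regions in row $i$ and the type $S_j$ regions in column $j$ of $X$, for $i,j\in\{1,\dots,n\}$. Suppose no region in $\mathcal R$ or $\mathcal S$ is empty, $\sum_i R_i=\sum_j S_j$, and $|\mathcal R|=|\mathcal S|=m$. Then there exists $A\in\mathcal W_n$ with row sums $R$ and column sums $S$ such that $A(k)=X$ if and only if there is no non-overlapping set of $r$ regions in $\mathcal R$ and $s$ regions in $\mathcal S$ with $r+s=m+1$.
   Context: $\mathcal W_n$ is the class of all $n\times n$ matrices with entries in $\{0,1,-1\}$ in which the non-zero entries of each row and each column alternate in sign, and the sum of each row and each column is in $\{0,\pm1\}$. For an $n\times n$ matrix $A$ with entries in $\{0,1,-1\}$ and $k\in\{1,-1\}$, $A(k)$ denotes the matrix obtained from $A$ by replacing all entries equal to $-k$ by $0$. Let $X$ be an $n\times n$ $(0,k)$-matrix, i.e. a matrix with entries in $\{0,k\}$. The row/column regions of $X$ are the contiguous $0$ entries occupying a single row/column of $X$ such that the first (resp. last) entry in the region is either the first (resp. last) entry of the row/column or has a non-zero directly before (resp. after) it. If two non-zero entries are next to one another, we say there is an empty row/column region between them. Types of regions: the type $k$ regions are the subset of row/column regions with the entry directly before and after the region equal to $k$; the type $-k$ regions are the entire set of row/column regions; the set of type $0$ regions contains each type $k$ region,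 and (as a single region) the union of the first and last row/column region of a row/column if they are disjoint. A set of row regions and column regions has an overlap if there is a row region and a column region among them with an entry (position) in common; otherwise it is non-overlapping.
   Formalization: Added assumption: no zero row i of X has R_i = k and no zero column j has S_j = k; without it the claim fails, e.g. n = 1, X = (0), R = S = (k), where there are no regions (m = 0) but no A exists. *)

theory Defs
  imports "Jordan_Normal_Form.Matrix"
begin

definition vec_sum :: "int vec \<Rightarrow> int" where
  "vec_sum v = (\<Sum>i<dim_vec v. v $ i)"

definition row_sums :: "int mat \<Rightarrow> int vec" where
  "row_sums A = vec (dim_row A) (\<lambda>i. vec_sum (row A i))"

definition col_sums :: "int mat \<Rightarrow> int vec" where
  "col_sums A = vec (dim_col A) (\<lambda>j. vec_sum (col A j))"

definition nonzeros_alternate :: "int vec \<Rightarrow> bool" where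
  "nonzeros_alternate v \<longleftrightarrow>
     (\<forall>a b. a < b \<and> b < dim_vec v \<and> v $ a \<noteq> 0 \<and> v $ b \<noteq> 0 \<and> (\<forall>c. a < c \<and> c < b \<longrightarrow> v $ c = 0)
        \<longrightarrow> sgn (v $ b) = - sgn (v $ a))"

text \<open>The class \<open>\<W>\<^sub>n\<close>.\<close>

definition weak_asm :: "nat \<Rightarrow> int mat set" where
  "weak_asm n = {A \<in> carrier_mat n n.
     elements_mat A \<subseteq> {0, 1, -1} \<and>
     (\<forall>i<n. nonzeros_alternate (row A i) \<and> vec_sum (row A i) \<in> {0, 1, -1}) \<and>
     (\<forall>j<n. nonzeros_alternate (col A j) \<and> vec_sum (col A j) \<in> {0, 1, -1})}"

text \<open>\<open>sign_part k A\<close> is \<open>A(k)\<close>.\<close>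

definition sign_part :: "int \<Rightarrow> int mat \<Rightarrow> int mat" where
  "sign_part k A = map_mat (\<lambda>x. if x = - k then 0 else x) A"

text \<open>
  \<open>is_region v a b\<close>: the positions \<open>a, \<dots>, b - 1\<close> form a region of the line (row or column) \<open>v\<close>.
  The case \<open>a = b\<close> is the empty region: between two adjacent non-zero entries, and also before
  a non-zero first entry or after a non-zero last entry. Hence a line with \<open>p\<close> non-zero entries
  has exactly \<open>p + 1\<close> regions; the first one always precedes all non-zero entries and the last
  one always follows them.
\<close>

definition is_region :: "int vec \<Rightarrow> nat \<Rightarrow> nat \<Rightarrow> bool" where
  "is_region v a b \<longleftrightarrow> a \<le> b \<and> b \<le> dim_vec v \<and> (\<forall>c. a \<le> c \<and> c < b \<longrightarrow> v $ c = 0) \<and>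
     (a = 0 \<or> v $ (a - 1) \<noteq> 0) \<and> (b = dim_vec v \<or> v $ b \<noteq> 0)"

definition all_regions :: "int vec \<Rightarrow> nat set set" where
  "all_regions v = {{a..<b} | a b. is_region v a b}"

definition bounded_regions :: "int \<Rightarrow> int vec \<Rightarrow> nat set set" where
  "bounded_regions k v =
     {{a..<b} | a b. is_region v a b \<and> 0 < a \<and> v $ (a - 1) = k \<and> b < dim_vec v \<and> v $ b = k}"

definition outer_regions :: "int vec \<Rightarrow> nat set set" where
  "outer_regions v = {{0..<b} \<union> {a..<dim_vec v} | a b.
     is_region v 0 b \<and> is_region v a (dim_vec v) \<and> {0..<b} \<inter> {a..<dim_vec v} = {}}"

text \<open>
  The type \<open>t\<close> regions of a line \<open>v\<close> with entries in \<open>{0, k}\<close>, where \<open>k\<close> is \<open>1\<close> or \<open>-1\<close> and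
  \<open>t\<close> is \<open>0\<close>, \<open>1\<close> or \<open>-1\<close>; the last branch is \<open>t = 0\<close>.
\<close>

definition regions_of_type :: "int \<Rightarrow> int \<Rightarrow> int vec \<Rightarrow> nat set set" where
  "regions_of_type k t v =
     (if t = k then bounded_regions k v
      else if t = - k then all_regions v
      else bounded_regions k v \<union> outer_regions v)"

text \<open>
  Regions of the matrix are sets of positions. Empty regions all become \<open>{}\<close>, so cardinalities
  count regions only when \<open>{}\<close> does not occur.
\<close>

definition row_regions :: "int \<Rightarrow> int mat \<Rightarrow> int vec \<Rightarrow> (nat \<times> nat) set set" where
  "row_regions k X R = {{i} \<times> I | i I. i < dim_row X \<and> I \<in> regions_of_type k (R $ i) (row X i)}"

definition col_regions :: "int \<Rightarrow> int mat \<Rightarrow> int vec \<Rightarrow> (nat \<times> nat) set set" where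
  "col_regions k X S = {I \<times> {j} | j I. j < dim_col X \<and> I \<in> regions_of_type k (S $ j) (col X j)}"

text \<open>
  A set of row and column regions is given by its row part and its column part, since a row
  region and a column region may consist of the same single position.
\<close>

definition non_overlapping :: "(nat \<times> nat) set set \<Rightarrow> (nat \<times> nat) set set \<Rightarrow> bool" where
  "non_overlapping P Q \<longleftrightarrow> (\<forall>p\<in>P. \<forall>q\<in>Q. p \<inter> q = {})"

text \<open>
  A line with \<open>p > 0\<close> entries \<open>k\<close> and no others has \<open>p - 1\<close>, \<open>p\<close>, \<open>p + 1\<close> regions of type
  \<open>k\<close>, \<open>0\<close>, \<open>-k\<close> respectively, and one entry \<open>-k\<close> in each of them gives the line sum \<open>k\<close>, \<open>0\<close>,
  \<open>-k\<close>. For \<open>p = 0\<close> this fails for type \<open>k\<close>: a zero line has no type \<open>k\<close> region, yet it cannot be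
  completed to a line of sum \<open>k\<close>. So a zero line with prescribed sum \<open>k\<close> must be excluded by
  hypothesis in the matching criterion; the \<open>1 \<times> 1\<close> matrix \<open>X = 0\<close> with \<open>R = S = (k)\<close> is
  otherwise a counterexample.
\<close>

end

theory Submission
  imports Defs "HOL-Library.Disjoint_Sets"
begin

text \<open>
  Writing \<open>- k\<close> into some zero positions \<open>N\<close> of \<open>X\<close> is the only way to obtain a matrix \<open>A\<close> with
  \<open>A(k) = X\<close>. Whether \<open>A\<close> is in \<open>\<W>\<^sub>n\<close> with the prescribed sums is decided line by line. The
  non-zero entries of a line alternate iff \<open>N\<close> has exactly one position in each region between two
  entries \<open>k\<close> and at most one in the first and in the last region. The sum of an alternating
  non-zero line is the mean of its first and last non-zero entry (\<open>alternating_sum\<close>). So, if the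
  line of \<open>X\<close> is not zero, the prescribed sum says in how many of the first and last regions \<open>N\<close> has
  a position: in none for \<open>k\<close>, in one for \<open>0\<close>, in both for \<open>- k\<close>. A zero line of \<open>X\<close> is a single
  region, which has one position of \<open>N\<close> for the sum \<open>- k\<close> and none for \<open>0\<close>. Altogether the line is
  as required iff \<open>N\<close> has exactly one position in each of its regions of the prescribed type and
  none elsewhere (\<open>line_completion_iff\<close>).

  Hence \<open>A\<close> exists iff a set of positions meets every region in \<open>\<R>\<close> and every region in \<open>\<S>\<close>
  exactly once and lies in both unions. As the regions within \<open>\<R>\<close>, and those within \<open>\<S>\<close>, are
  pairwise disjoint, such a set is a perfect matching between overlapping members of \<open>\<R>\<close> and \<open>\<S>\<close>,
  and Hall's theorem turns its absence into a non-overlapping set of \<open>m + 1\<close> regions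
  (\<open>ex_common_exact_transversal_iff\<close>).
\<close>

section \<open>Hall's theorem\<close>

text \<open>
  Rado's argument: if a set of the family has two elements, then one of them can be removed without
  destroying Hall's condition, because two families of violating indices, one for each removal,
  would contradict the submodularity of \<open>J \<mapsto> card (\<Union>i\<in>J. A i)\<close>. Once all sets are singletons
  there is nothing left to choose.
\<close>

theorem hall_marriage:
  assumes "finite I" "\<And>i. i \<in> I \<Longrightarrow> finite (A i)"
    and "\<And>J. J \<subseteq> I \<Longrightarrow> card J \<le> card (\<Union>i\<in>J. A i)"
  shows "\<exists>f. (\<forall>i\<in>I. f i \<in> A i) \<and> inj_on f I"
  using assms(2-)
proof (induction "\<Sum>i\<in>I. card (A i)" arbitrary: A rule: less_induct)
  case less
  note fin = less.prems(1) and hall = less.prems(2)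
  show ?case
  proof (cases "\<exists>i\<in>I. \<exists>x\<in>A i. \<exists>y\<in>A i. x \<noteq> y")
    case False
    have ne: "A i \<noteq> {}" if "i \<in> I" for i
      using hall[of "{i}"] that by auto
    define f where "f i = (SOME x. x \<in> A i)" for i
    have f: "f i \<in> A i" if "i \<in> I" for i
      using ne[OF that] unfolding f_def by (simp add: some_in_eq)
    have A: "A i = {f i}" if "i \<in> I" for i
      using False f that by blast
    have "inj_on f I"
    proof (rule inj_onI, rule ccontr)
      fix i j assume ij: "i \<in> I" "j \<in> I" "f i = f j" "i \<noteq> j"
      then have "(\<Union>l\<in>{i, j}. A l) = {f i}" using A[of i] A[of j] by auto
      then show False using hall[of "{i, j}"] ij by simp
    qed
    then show ?thesis using f by blast
  next
    case True
    then obtain i x y where i: "i \<in> I" and x: "x \<in> A i" and y: "y \<in> A i" and xy: "x \<noteq> y"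
      by blast
    define B where "B z = A(i := A i - {z})" for z
    have sub: "B z j \<subseteq> A j" for z j by (auto simp: B_def)
    have smaller: "(\<Sum>j\<in>I. card (B z j)) < (\<Sum>j\<in>I. card (A j))" if "z \<in> A i" for z
    proof (rule sum_strict_mono_ex1[OF \<open>finite I\<close>])
      show "\<forall>j\<in>I. card (B z j) \<le> card (A j)" using fin sub by (blast intro: card_mono)
      show "\<exists>j\<in>I. card (B z j) < card (A j)"
        using card_Diff1_less[OF fin[OF i] that] by (intro bexI[OF _ i]) (simp only: B_def fun_upd_same)
    qed
    have finB: "finite (B z j)" if "j \<in> I" for z j
      using fin[OF that] sub by (rule finite_subset[rotated])
    have violation: "\<exists>J. J \<subseteq> I - {i} \<and> card ((\<Union>j\<in>J. A j) \<union> (A i - {z})) \<le> card J"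
      if bad: "\<not> (\<forall>J. J \<subseteq> I \<longrightarrow> card J \<le> card (\<Union>j\<in>J. B z j))" for z
    proof -
      obtain J where J: "J \<subseteq> I" "card (\<Union>j\<in>J. B z j) < card J" using bad by auto
      have "i \<in> J"
      proof (rule ccontr)
        assume "i \<notin> J"
        then have "(\<Union>j\<in>J. B z j) = (\<Union>j\<in>J. A j)" by (auto simp: B_def)
        then show False using hall[OF J(1)] J(2) by simp
      qed
      moreover have "(\<Union>j\<in>J. B z j) = (\<Union>j\<in>J - {i}. A j) \<union> (A i - {z})"
        using \<open>i \<in> J\<close> by (auto simp: B_def split: if_splits)
      moreover have "finite J" using J(1) \<open>finite I\<close> by (rule finite_subset)
      ultimately show ?thesis using J by (intro exI[of _ "J - {i}"]) auto
    qed
    have "(\<forall>J. J \<subseteq> I \<longrightarrow> card J \<le> card (\<Union>j\<in>J. B x j)) \<or>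
          (\<forall>J. J \<subseteq> I \<longrightarrow> card J \<le> card (\<Union>j\<in>J. B y j))"
    proof (rule ccontr)
      assume "\<not> ?thesis"
      then obtain J K where J: "J \<subseteq> I - {i}" "card ((\<Union>j\<in>J. A j) \<union> (A i - {x})) \<le> card J"
        and K: "K \<subseteq> I - {i}" "card ((\<Union>j\<in>K. A j) \<union> (A i - {y})) \<le> card K"
        using violation[of x] violation[of y] by blast
      let ?U = "(\<Union>j\<in>J. A j) \<union> (A i - {x})" and ?V = "(\<Union>j\<in>K. A j) \<union> (A i - {y})"
      have finJK: "finite J" "finite K" using J(1) K(1) \<open>finite I\<close> by (meson finite_Diff finite_subset)+
      have finUV: "finite ?U" "finite ?V" using finJK J(1) K(1) fin i by auto
      have "card (J \<union> K) + 1 = card (insert i (J \<union> K))" using finJK J(1) K(1)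
        by (subst card_insert_disjoint) auto
      also have "\<dots> \<le> card (\<Union>j\<in>insert i (J \<union> K). A j)" using i J(1) K(1) by (intro hall) auto
      also have "\<dots> \<le> card (?U \<union> ?V)" using finUV xy by (intro card_mono) auto
      finally have union: "card (J \<union> K) + 1 \<le> card (?U \<union> ?V)" .
      have "card (J \<inter> K) \<le> card (\<Union>j\<in>J \<inter> K. A j)" using J(1) by (intro hall) auto
      also have "\<dots> \<le> card (?U \<inter> ?V)" using finUV by (intro card_mono) auto
      finally have "card (J \<inter> K) \<le> card (?U \<inter> ?V)" .
      with union J(2) K(2) card_Un_Int[OF finUV] card_Un_Int[OF finJK] show False by linarith
    qed
    then obtain z where z: "z \<in> A i" "\<And>J. J \<subseteq> I \<Longrightarrow> card J \<le> card (\<Union>j\<in>J. B z j)"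
      using x y by blast
    obtain f where "\<forall>j\<in>I. f j \<in> B z j" "inj_on f I"
      using less.hyps[OF smaller[OF z(1)] finB z(2)] by blast
    then show ?thesis using sub by blast
  qed
qed


section \<open>Common exact transversals of two disjoint families\<close>

definition exact_transversal :: "'a set \<Rightarrow> 'a set set \<Rightarrow> bool" where
  "exact_transversal N \<F> \<longleftrightarrow> N \<subseteq> \<Union>\<F> \<and> (\<forall>I\<in>\<F>. \<exists>!c. c \<in> I \<inter> N)"

lemma card_exact_transversal_subfamily:
  assumes N: "exact_transversal N \<F>" and dis: "disjoint \<F>" and "\<P> \<subseteq> \<F>"
  shows "card (N \<inter> \<Union>\<P>) = card \<P>"
proof -
  define c where "c I = (THE x. x \<in> I \<inter> N)" for I
  have c: "c I \<in> I \<inter> N" and uniq: "x \<in> I \<inter> N \<Longrightarrow> x = c I" if "I \<in> \<F>" for I x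
  proof -
    have ex: "\<exists>!x. x \<in> I \<inter> N" using N that by (auto simp: exact_transversal_def)
    show "c I \<in> I \<inter> N" unfolding c_def by (rule theI'[OF ex])
    then show "x \<in> I \<inter> N \<Longrightarrow> x = c I" using ex by blast
  qed
  have "inj_on c \<P>"
  proof (rule inj_onI, rule ccontr)
    fix I J assume "I \<in> \<P>" "J \<in> \<P>" "c I = c J" "I \<noteq> J"
    then have "c I \<in> I \<inter> J" "I \<inter> J = {}"
      using c[of I] c[of J] \<open>\<P> \<subseteq> \<F>\<close> disjointD[OF dis, of I J] by auto
    then show False by simp
  qed
  moreover have "c ` \<P> = N \<inter> \<Union>\<P>" using c uniq \<open>\<P> \<subseteq> \<F>\<close> by blast
  ultimately show ?thesis using card_image[of c \<P>] by simp
qed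

text \<open>
  A common exact transversal is the same as a perfect matching of the bipartite graph that joins
  \<open>P \<in> \<R>\<close> and \<open>Q \<in> \<S>\<close> when they meet: choose one point in each matched pair. The obstruction is
  the independent set of Koenig's theorem, and it comes from Hall's theorem as follows: if \<open>J \<subseteq> \<R>\<close>
  has fewer than \<open>card J\<close> neighbours, then \<open>J\<close> together with the members of \<open>\<S>\<close> that miss \<open>\<Union>J\<close>
  is non-overlapping and has more than \<open>m\<close> members.
\<close>

theorem ex_common_exact_transversal_iff:
  assumes fin: "finite \<R>" "finite \<S>" and card: "card \<R> = m" "card \<S> = m"
    and dis: "disjoint \<R>" "disjoint \<S>"
  shows "(\<exists>N. exact_transversal N \<R> \<and> exact_transversal N \<S>) \<longleftrightarrow>
    \<not> (\<exists>\<P> \<Q>. \<P> \<subseteq> \<R> \<and> \<Q> \<subseteq> \<S> \<and> card \<P> + card \<Q> = m + 1 \<and> (\<forall>P\<in>\<P>. \<forall>Q\<in>\<Q>. P \<inter> Q = {}))"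
    (is "?matching \<longleftrightarrow> \<not> ?independent")
proof
  assume ?matching
  then obtain N where N: "exact_transversal N \<R>" "exact_transversal N \<S>" by blast
  show "\<not> ?independent"
  proof clarify
    fix \<P> \<Q> assume PQ: "\<P> \<subseteq> \<R>" "\<Q> \<subseteq> \<S>" "card \<P> + card \<Q> = m + 1"
      and indep: "\<forall>P\<in>\<P>. \<forall>Q\<in>\<Q>. P \<inter> Q = {}"
    have "N \<inter> \<Union>\<R> = N" using N(1) by (simp add: exact_transversal_def Int_absorb2)
    then have cardN: "card N = m"
      using card_exact_transversal_subfamily[OF N(1) dis(1) order.refl] card by simp
    have finN: "finite N"
    proof (cases "m = 0")
      case True
      then show ?thesis using N(1) fin card by (auto simp: exact_transversal_def)
    next
      case False
      then show ?thesis using cardN card.infinite by fastforce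
    qed
    have "(N \<inter> \<Union>\<P>) \<inter> (N \<inter> \<Union>\<Q>) = {}" using indep by blast
    then have "card (N \<inter> \<Union>\<P>) + card (N \<inter> \<Union>\<Q>) = card ((N \<inter> \<Union>\<P>) \<union> (N \<inter> \<Union>\<Q>))"
      using finN by (simp add: card_Un_disjoint)
    also have "\<dots> \<le> m" unfolding cardN[symmetric] using finN by (intro card_mono) auto
    finally show False
      using PQ card_exact_transversal_subfamily[OF N(1) dis(1) PQ(1)]
        card_exact_transversal_subfamily[OF N(2) dis(2) PQ(2)] by simp
  qed
next
  assume indep: "\<not> ?independent"
  define meets where "meets P = {Q \<in> \<S>. P \<inter> Q \<noteq> {}}" for P
  have hall: "card \<J> \<le> card (\<Union>P\<in>\<J>. meets P)" if "\<J> \<subseteq> \<R>" for \<J>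
  proof (rule ccontr)
    assume less: "\<not> ?thesis"
    let ?N = "\<Union>P\<in>\<J>. meets P"
    have "?N \<subseteq> \<S>" by (auto simp: meets_def)
    then have "card (\<S> - ?N) = m - card ?N"
      using card fin by (simp add: card_Diff_subset finite_subset)
    then have "m + 1 - card \<J> \<le> card (\<S> - ?N)" using less by linarith
    \<comment> \<open>The complement of the neighbourhood may be larger than needed; the two sizes must sum to
      exactly \<open>m + 1\<close>.\<close>
    then obtain \<Q> where Q: "\<Q> \<subseteq> \<S> - ?N" "card \<Q> = m + 1 - card \<J>"
      by (meson obtain_subset_with_card_n)
    have "card \<J> \<le> m" using card_mono[OF fin(1) that] card by simp
    then have "card \<J> + card \<Q> = m + 1" using Q(2) by simp
    moreover have "\<forall>P\<in>\<J>. \<forall>Q\<in>\<Q>. P \<inter> Q = {}"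
    proof (intro ballI)
      fix P Q assume "P \<in> \<J>" "Q \<in> \<Q>"
      then have "Q \<in> \<S>" "Q \<notin> meets P" using Q(1) by blast+
      then show "P \<inter> Q = {}" by (simp add: meets_def)
    qed
    moreover have "\<Q> \<subseteq> \<S>" using Q(1) by blast
    ultimately show False using indep that by blast
  qed
  obtain f where f: "\<forall>P\<in>\<R>. f P \<in> meets P" "inj_on f \<R>"
    using hall_marriage[of \<R> meets] fin hall by (auto simp: meets_def)
  have onto: "f ` \<R> = \<S>"
    using f fin card by (intro card_subset_eq) (auto simp: meets_def card_image)
  define x where "x P = (SOME y. y \<in> P \<inter> f P)" for P
  have x: "x P \<in> P" "x P \<in> f P" if "P \<in> \<R>" for P
  proof -
    have "P \<inter> f P \<noteq> {}" using f(1) that by (auto simp: meets_def)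
    then have "x P \<in> P \<inter> f P" unfolding x_def by (rule some_in_eq[THEN iffD2])
    then show "x P \<in> P" "x P \<in> f P" by auto
  qed
  have "exact_transversal (x ` \<R>) \<R>"
    unfolding exact_transversal_def
  proof (intro conjI ballI)
    show "x ` \<R> \<subseteq> \<Union>\<R>" using x by auto
    fix P assume P: "P \<in> \<R>"
    show "\<exists>!c. c \<in> P \<inter> x ` \<R>"
    proof (rule ex1I[of _ "x P"])
      show "x P \<in> P \<inter> x ` \<R>" using x P by auto
      fix c assume "c \<in> P \<inter> x ` \<R>"
      then obtain P' where "P' \<in> \<R>" "c = x P'" "c \<in> P" by auto
      then show "c = x P" using x(1)[of P'] P disjointD[OF dis(1), of P P'] by blast
    qed
  qed
  moreover have "exact_transversal (x ` \<R>) \<S>"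
    unfolding exact_transversal_def
  proof (intro conjI ballI)
    show "x ` \<R> \<subseteq> \<Union>\<S>" using x onto by blast
    fix Q assume "Q \<in> \<S>"
    then obtain P where P: "P \<in> \<R>" "Q = f P" using onto by auto
    show "\<exists>!c. c \<in> Q \<inter> x ` \<R>"
    proof (rule ex1I[of _ "x P"])
      show "x P \<in> Q \<inter> x ` \<R>" using x P by auto
      fix c assume "c \<in> Q \<inter> x ` \<R>"
      then obtain P' where P': "P' \<in> \<R>" "c = x P'" "c \<in> Q" by auto
      then have "f P' = f P"
        using x(2)[of P'] P onto disjointD[OF dis(2), of "f P" "f P'"] by blast
      then show "c = x P" using P P' f(2) by (auto dest: inj_onD)
    qed
  qed
  ultimately show ?matching by blast
qed

text \<open>
  The common form of the row regions and the column regions of a matrix: \<open>h i c\<close> is the \<open>c\<close>-th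
  position of the \<open>i\<close>-th line, and \<open>\<F> i\<close> is a family of sets of positions in that line.
\<close>

lemma exact_transversal_lines:
  assumes inj [simp]: "\<And>i c i' c'. h i c = h i' c' \<longleftrightarrow> i = i' \<and> c = c'"
    and N: "\<And>x. x \<in> N \<Longrightarrow> \<exists>i<n. \<exists>c. x = h i c"
  shows "exact_transversal N {h i ` I | i I. i < n \<and> I \<in> \<F> i} \<longleftrightarrow>
    (\<forall>i<n. exact_transversal {c. h i c \<in> N} (\<F> i))"
proof -
  have "N \<subseteq> \<Union>{h i ` I | i I. i < n \<and> I \<in> \<F> i} \<longleftrightarrow> (\<forall>i<n. {c. h i c \<in> N} \<subseteq> \<Union>(\<F> i))"
    (is "?l \<longleftrightarrow> ?r")
  proof
    assume ?l
    show ?r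
    proof clarify
      fix i c assume "i < n" "h i c \<in> N"
      then obtain i' I where "I \<in> \<F> i'" "h i c \<in> h i' ` I" using \<open>?l\<close> by blast
      then show "c \<in> \<Union>(\<F> i)" by auto
    qed
  next
    assume ?r
    show ?l
    proof
      fix x assume "x \<in> N"
      then obtain i c where "i < n" "x = h i c" using N by blast
      moreover from this have "c \<in> \<Union>(\<F> i)" using \<open>?r\<close> \<open>x \<in> N\<close> by auto
      ultimately show "x \<in> \<Union>{h i ` I | i I. i < n \<and> I \<in> \<F> i}" by auto
    qed
  qed
  moreover have "(\<exists>!x. x \<in> h i ` I \<inter> N) \<longleftrightarrow> (\<exists>!c. c \<in> I \<inter> {c. h i c \<in> N})" for i I
  proof
    assume "\<exists>!x. x \<in> h i ` I \<inter> N"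
    then obtain c where c: "c \<in> I" "h i c \<in> N" and uniq: "\<And>x. x \<in> h i ` I \<inter> N \<Longrightarrow> x = h i c"
      by (blast elim: ex1E)
    show "\<exists>!c. c \<in> I \<inter> {c. h i c \<in> N}"
    proof (rule ex1I[of _ c])
      fix d assume "d \<in> I \<inter> {c. h i c \<in> N}"
      then have "h i d = h i c" by (intro uniq) auto
      then show "d = c" by simp
    qed (use c in simp)
  next
    assume "\<exists>!c. c \<in> I \<inter> {c. h i c \<in> N}"
    then obtain c where c: "c \<in> I" "h i c \<in> N" and uniq: "\<And>d. d \<in> I \<inter> {c. h i c \<in> N} \<Longrightarrow> d = c"
      by (metis IntD1 IntD2 mem_Collect_eq)
    show "\<exists>!x. x \<in> h i ` I \<inter> N"
    proof (rule ex1I[of _ "h i c"])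
      fix x assume "x \<in> h i ` I \<inter> N"
      then obtain d where d: "x = h i d" "d \<in> I \<inter> {c. h i c \<in> N}" by blast
      from uniq[OF d(2)] d(1) show "x = h i c" by simp
    qed (use c in blast)
  qed
  moreover have "{h i ` I | i I. i < n \<and> I \<in> \<F> i} = (\<Union>i\<in>{..<n}. (`) (h i) ` \<F> i)" by auto
  moreover have "(\<forall>i\<in>{..<n}. P i) \<longleftrightarrow> (\<forall>i<n. P i)" for P by auto
  ultimately show ?thesis by (simp add: exact_transversal_def imp_conjR all_conj_distrib)
qed

lemma disjoint_lines:
  assumes inj [simp]: "\<And>i c i' c'. h i c = h i' c' \<longleftrightarrow> i = i' \<and> c = c'"
    and "\<And>i. i < n \<Longrightarrow> disjoint (\<F> i)"
  shows "disjoint {h i ` I | i I. i < n \<and> I \<in> \<F> i}"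
proof (rule disjointI)
  fix P Q assume "P \<in> {h i ` I | i I. i < n \<and> I \<in> \<F> i}" "Q \<in> {h i ` I | i I. i < n \<and> I \<in> \<F> i}"
    and "P \<noteq> Q"
  then obtain i I j J where *: "P = h i ` I" "i < n" "I \<in> \<F> i" "Q = h j ` J" "j < n" "J \<in> \<F> j"
    by blast
  show "P \<inter> Q = {}"
  proof (cases "i = j")
    case True
    then have "I \<inter> J = {}" using * \<open>P \<noteq> Q\<close> assms(2) by (auto dest: disjointD)
    then show ?thesis using * True by auto
  next
    case False
    then show ?thesis using * by auto
  qed
qed


section \<open>Regions of a line\<close>

lemma is_region_unique:
  assumes "is_region v a b" "is_region v a' b'" "c \<in> {a..<b}" "c \<in> {a'..<b'}"
  shows "a = a' \<and> b = b'"
proof -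
  have le: "a' \<le> a \<and> b \<le> b'"
    if "is_region v a b" "is_region v a' b'" "c \<in> {a..<b}" "c \<in> {a'..<b'}" for a b a' b'
  proof (rule conjI; rule ccontr)
    assume "\<not> a' \<le> a"
    then have "a \<le> a' - 1" "a' - 1 < b" "v $ (a' - 1) \<noteq> 0"
      using that by (auto simp: is_region_def)
    then show False using that(1) by (auto simp: is_region_def)
  next
    assume "\<not> b \<le> b'"
    then have "a \<le> b'" "b' < b" "v $ b' \<noteq> 0"
      using that by (auto simp: is_region_def)
    then show False using that(1) by (auto simp: is_region_def)
  qed
  from le[OF assms] le[OF assms(2,1,4,3)] show ?thesis by simp
qed

lemma ex_region_containing:
  assumes "c < dim_vec v" "v $ c = 0"
  shows "\<exists>a b. is_region v a b \<and> c \<in> {a..<b}"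
proof -
  define a where "a = (LEAST a. a \<le> c \<and> (\<forall>d. a \<le> d \<and> d \<le> c \<longrightarrow> v $ d = 0))"
  have a: "a \<le> c \<and> (\<forall>d. a \<le> d \<and> d \<le> c \<longrightarrow> v $ d = 0)"
    unfolding a_def by (rule LeastI[of _ c]) (use assms in auto)
  define b where "b = (LEAST b. c \<le> b \<and> (b = dim_vec v \<or> v $ b \<noteq> 0))"
  have b: "c \<le> b \<and> (b = dim_vec v \<or> v $ b \<noteq> 0)"
    unfolding b_def by (rule LeastI[of _ "dim_vec v"]) (use assms in auto)
  have "b \<le> dim_vec v" unfolding b_def by (rule Least_le) (use assms in auto)
  have "v $ d = 0" if "c \<le> d" "d < b" for d
    using not_less_Least[of d "\<lambda>b. c \<le> b \<and> (b = dim_vec v \<or> v $ b \<noteq> 0)"] that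
    unfolding b_def by auto
  moreover have "a = 0 \<or> v $ (a - 1) \<noteq> 0"
  proof (rule ccontr)
    assume *: "\<not> ?thesis"
    have "v $ d = 0" if "a - 1 \<le> d" "d \<le> c" for d
      using a * that by (cases "d = a - 1") auto
    then have "a \<le> a - 1" unfolding a_def[symmetric] using a
      by (subst (1) a_def, intro Least_le) auto
    then have "a = 0" by arith
    then show False using * by simp
  qed
  moreover have "c \<noteq> b" using b assms by auto
  ultimately show ?thesis using a b \<open>b \<le> dim_vec v\<close>
    by (intro exI[of _ a] exI[of _ b]) (auto simp: is_region_def; metis nat_le_linear)
qed

lemma disjoint_all_regions: "disjoint (all_regions v)"
proof (rule disjointI)
  fix I J assume "I \<in> all_regions v" "J \<in> all_regions v" "I \<noteq> J"
  then show "I \<inter> J = {}" unfolding all_regions_def using is_region_unique by blast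
qed

lemma bounded_regions_subset: "bounded_regions k v \<subseteq> all_regions v"
  by (auto simp: bounded_regions_def all_regions_def)

lemma outer_regions_unique:
  assumes "I \<in> outer_regions v" "J \<in> outer_regions v"
  shows "I = J"
proof -
  have "b = b'" if "is_region v 0 b" "is_region v 0 b'" for b b'
    using that unfolding is_region_def by (metis less_eq_nat.simps(1) linorder_neqE_nat not_le)
  moreover have "a = a'" if "is_region v a (dim_vec v)" "is_region v a' (dim_vec v)" for a a'
  proof -
    have "a' \<le> a" if "is_region v a (dim_vec v)" "is_region v a' (dim_vec v)" for a a'
    proof (rule ccontr)
      assume "\<not> a' \<le> a"
      then have "a \<le> a' - 1" "a' - 1 < dim_vec v" "v $ (a' - 1) \<noteq> 0"
        using that by (auto simp: is_region_def)
      then show False using that(1) by (auto simp: is_region_def)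
    qed
    then show ?thesis using that by (simp add: order.antisym)
  qed
  ultimately show ?thesis using assms unfolding outer_regions_def by blast
qed

lemma bounded_outer_disjoint:
  assumes "I \<in> bounded_regions k v" "J \<in> outer_regions v"
  shows "I \<inter> J = {}"
proof -
  obtain a b where I: "I = {a..<b}" "is_region v a b" "0 < a" "b < dim_vec v"
    using assms(1) by (auto simp: bounded_regions_def)
  obtain a' b' where J: "J = {0..<b'} \<union> {a'..<dim_vec v}" "is_region v 0 b'"
      "is_region v a' (dim_vec v)"
    using assms(2) by (auto simp: outer_regions_def)
  show ?thesis using is_region_unique[OF I(2) J(2)] is_region_unique[OF I(2) J(3)] I J(1) by blast
qed

lemma disjoint_regions_of_type: "disjoint (regions_of_type k t v)"
proof -
  have "disjoint (bounded_regions k v \<union> outer_regions v)"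
  proof (rule disjointI)
    fix I J assume IJ: "I \<in> bounded_regions k v \<union> outer_regions v"
      "J \<in> bounded_regions k v \<union> outer_regions v" "I \<noteq> J"
    then show "I \<inter> J = {}"
      using disjointD[OF disjoint_all_regions, of I v J] bounded_regions_subset[of k v]
        outer_regions_unique[of I v J] bounded_outer_disjoint[of I k v J]
        bounded_outer_disjoint[of J k v I] by blast
  qed
  then show ?thesis
    using disjoint_all_regions pairwise_subset[OF disjoint_all_regions bounded_regions_subset]
    by (auto simp: regions_of_type_def)
qed

lemma regions_of_type_bound:
  assumes "I \<in> regions_of_type k t v"
  shows "I \<subseteq> {..<dim_vec v}"
  using assms
  by (fastforce simp: regions_of_type_def bounded_regions_def outer_regions_def all_regions_def
      is_region_def split: if_splits)


section \<open>Completing a line\<close>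

lemma obtain_last_nonzero:
  fixes f :: "nat \<Rightarrow> 'a::zero"
  assumes "p < n" "f p \<noteq> 0"
  obtains q where "p \<le> q" "q < n" "f q \<noteq> 0" "\<And>c. q < c \<Longrightarrow> c < n \<Longrightarrow> f c = 0"
proof -
  let ?C = "{c. c < n \<and> f c \<noteq> 0}"
  have p: "p \<in> ?C" and fin: "finite ?C" using assms by auto
  show ?thesis
  proof (rule that)
    show "p \<le> Max ?C" by (rule Max_ge[OF fin p])
    have "Max ?C \<in> ?C" using fin p by (intro Max_in) blast+
    then show "Max ?C < n" "f (Max ?C) \<noteq> 0" by simp_all
    show "f c = 0" if "Max ?C < c" "c < n" for c
    proof (rule ccontr)
      assume "f c \<noteq> 0"
      then have "c \<le> Max ?C" using that(2) by (intro Max_ge[OF fin]) simp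
      then show False using that(1) by simp
    qed
  qed
qed

lemma nonzeros_alternateD:
  assumes "nonzeros_alternate v" "a < b" "b < dim_vec v" "v $ a \<noteq> 0" "v $ b \<noteq> 0"
    and "\<And>c. a < c \<Longrightarrow> c < b \<Longrightarrow> v $ c = 0"
  shows "sgn (v $ b) = - sgn (v $ a)"
  using assms unfolding nonzeros_alternate_def by blast

text \<open>
  In an alternating \<open>\<plusminus>1\<close> word adjacent letters cancel in pairs, so that its sum is the mean of its
  first and its last letter.
\<close>

lemma alternating_sum:
  fixes f :: "nat \<Rightarrow> int"
  assumes "\<And>c. c < n \<Longrightarrow> f c \<in> {0, 1, -1}"
    and "\<And>a b. \<lbrakk>a < b; b < n; f a \<noteq> 0; f b \<noteq> 0; \<forall>c. a < c \<and> c < b \<longrightarrow> f c = 0\<rbrakk>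
      \<Longrightarrow> sgn (f b) = - sgn (f a)"
    and "f p \<noteq> 0" "\<forall>c<p. f c = 0"
    and "p \<le> q" "q < n" "f q \<noteq> 0"
  shows "2 * (\<Sum>c\<le>q. f c) = f p + f q"
  using assms(5-)
proof (induction q rule: less_induct)
  case (less q)
  show ?case
  proof (cases "q = p")
    case True
    have "(\<Sum>c\<le>p. f c) = (\<Sum>c\<in>{p}. f c)" using assms(4) by (intro sum.mono_neutral_right) auto
    then show ?thesis using True by simp
  next
    case False
    obtain r where r: "p \<le> r" "r < q" "f r \<noteq> 0" and zero: "\<And>c. r < c \<Longrightarrow> c < q \<Longrightarrow> f c = 0"
      using obtain_last_nonzero[of p q f] False less.prems(1) assms(3) by auto
    have "sgn (f q) = - sgn (f r)" using assms(2)[of r q] r zero less.prems by blast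
    moreover have "f q \<in> {0, 1, -1}" "f r \<in> {0, 1, -1}" using assms(1)[of q] assms(1)[of r] r less.prems by auto
    ultimately have "f q = - f r" by auto
    moreover have "(\<Sum>c\<le>q. f c) = (\<Sum>c\<in>insert q {..r}. f c)"
      using zero r by (intro sum.mono_neutral_right) (auto simp: not_le)
    moreover have "2 * (\<Sum>c\<le>r. f c) = f p + f r"
      using less.IH[of r] r less.prems by simp
    ultimately show ?thesis using r by simp
  qed
qed

text \<open>
  The situation of a line \<open>w\<close> of \<open>A\<close> and the same line \<open>v\<close> of \<open>A(k)\<close>.
\<close>

locale completed_line =
  fixes k :: int and v w :: "int vec"
  assumes k: "k \<in> {-1, 1}"
    and dim: "dim_vec w = dim_vec v"
    and entries: "\<And>c. c < dim_vec v \<Longrightarrow> w $ c \<in> {0, 1, -1}"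
    and erase: "\<And>c. c < dim_vec v \<Longrightarrow> v $ c = (if w $ c = - k then 0 else w $ c)"
begin

definition new :: "nat set" where
  "new = {c. c < dim_vec v \<and> w $ c = - k}"

lemma letters:
  assumes "c < dim_vec v"
  shows "v $ c \<noteq> 0 \<longleftrightarrow> w $ c = k" "v $ c \<noteq> 0 \<longleftrightarrow> v $ c = k"
    and "w $ c \<noteq> 0 \<longleftrightarrow> v $ c \<noteq> 0 \<or> c \<in> new" "c \<in> new \<Longrightarrow> v $ c = 0"
  using entries[OF assms] erase[OF assms] k assms by (auto simp: new_def)

lemma new_subset_regions: "new \<subseteq> \<Union>(all_regions v)"
proof
  fix c assume c: "c \<in> new"
  then have "c < dim_vec v" "v $ c = 0" using letters by (auto simp: new_def)
  then obtain a b where "is_region v a b" "c \<in> {a..<b}" using ex_region_containing by blast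
  then show "c \<in> \<Union>(all_regions v)" unfolding all_regions_def by blast
qed

text \<open>
  The two ways in which alternation can fail: two consecutive non-zero entries \<open>- k\<close> lie in the same
  region, and two consecutive non-zero entries \<open>k\<close> enclose a region without entry \<open>- k\<close>.
\<close>

lemma alternate_iff:
  "nonzeros_alternate w \<longleftrightarrow>
     (\<forall>I\<in>all_regions v. \<forall>c\<in>I \<inter> new. \<forall>d\<in>I \<inter> new. c = d) \<and> (\<forall>I\<in>bounded_regions k v. I \<inter> new \<noteq> {})"
    (is "_ \<longleftrightarrow> ?unique \<and> ?hit")
proof
  assume alt: "nonzeros_alternate w"
  have False if I: "is_region v a b" and cd: "c \<in> {a..<b} \<inter> new" "d \<in> {a..<b} \<inter> new" "c < d"
    for a b c d
  proof -
    \<comment> \<open>The next non-zero entry after \<open>c\<close> is still inside the region, hence \<open>- k\<close> like the one in \<open>c\<close>.\<close>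
    define e where "e = (LEAST e. c < e \<and> w $ e \<noteq> 0)"
    have d: "c < d \<and> w $ d \<noteq> 0" using cd k by (auto simp: new_def)
    have e: "c < e \<and> w $ e \<noteq> 0" unfolding e_def by (rule LeastI[of _ d]) (rule d)
    have "e \<le> d" unfolding e_def by (rule Least_le) (rule d)
    have between: "\<forall>x. c < x \<and> x < e \<longrightarrow> w $ x = 0"
      unfolding e_def using not_less_Least by blast
    have "e < dim_vec v" "v $ e = 0" using I \<open>e \<le> d\<close> e cd by (auto simp: is_region_def)
    then have "w $ e = - k" using e letters(3)[of e] by (auto simp: new_def)
    moreover have "sgn (w $ e) = - sgn (w $ c)"
      using e between \<open>e < dim_vec v\<close> cd(1) k dim
      by (intro nonzeros_alternateD[OF alt]) (auto simp: new_def)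
    ultimately show False using cd(1) k by (auto simp: new_def)
  qed
  then have ?unique unfolding all_regions_def by (auto, metis atLeastLessThan_iff Int_iff linorder_neqE_nat)
  moreover have ?hit
  proof
    fix I assume "I \<in> bounded_regions k v"
    then obtain a b where I: "I = {a..<b}" "is_region v a b" "0 < a" "v $ (a - 1) = k"
        "b < dim_vec v" "v $ b = k"
      by (auto simp: bounded_regions_def)
    have ab: "a \<le> b" using I(2) by (simp add: is_region_def)
    have w: "w $ (a - 1) = k" "w $ b = k" using I ab k letters(1)[of b] letters(1)[of "a - 1"] by auto
    show "I \<inter> new \<noteq> {}"
    proof
      assume none: "I \<inter> new = {}"
      have "w $ c = 0" if "a - 1 < c" "c < b" for c
      proof -
        have "c \<in> I" "c < dim_vec v" using that I by auto
        moreover have "v $ c = 0" using I(2) that by (auto simp: is_region_def)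
        ultimately show ?thesis using none letters(3)[of c] by blast
      qed
      then have "sgn (w $ b) = - sgn (w $ (a - 1))"
        using I(3,5) ab w k dim by (intro nonzeros_alternateD[OF alt]) auto
      then show False using w k by auto
    qed
  qed
  ultimately show "?unique \<and> ?hit" by blast
next
  assume asm: "?unique \<and> ?hit"
  then have unique: "c = d" if "I \<in> all_regions v" "c \<in> I \<inter> new" "d \<in> I \<inter> new" for I c d
    using that by blast
  show "nonzeros_alternate w"
    unfolding nonzeros_alternate_def
  proof (intro allI impI, elim conjE)
    fix a b assume "a < b" "b < dim_vec w" "w $ a \<noteq> 0" "w $ b \<noteq> 0"
      and between: "\<forall>c. a < c \<and> c < b \<longrightarrow> w $ c = 0"
    note ab = \<open>a < b\<close> \<open>b < dim_vec w\<close> \<open>w $ a \<noteq> 0\<close> \<open>w $ b \<noteq> 0\<close>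
    have lt: "a < dim_vec v" "b < dim_vec v" using ab dim by auto
    have v0: "v $ c = 0" if "a < c" "c < b" for c
      using between that letters(3)[of c] lt by auto
    have "\<not> (w $ a = k \<and> w $ b = k)"
    proof
      assume kk: "w $ a = k \<and> w $ b = k"
      then have "v $ a = k" "v $ b = k" using lt letters by blast+
      then have "is_region v (Suc a) b" using ab(1) lt v0 k by (auto simp: is_region_def)
      then have "{Suc a..<b} \<in> bounded_regions k v" unfolding bounded_regions_def
        using \<open>v $ a = k\<close> \<open>v $ b = k\<close> lt by (intro CollectI exI[of _ "Suc a"] exI[of _ b]) simp
      then obtain c where "Suc a \<le> c" "c < b" "c \<in> new" using asm by fastforce
      then show False using between k by (auto simp: new_def)
    qed
    moreover have "\<not> (w $ a = - k \<and> w $ b = - k)"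
    proof
      assume "w $ a = - k \<and> w $ b = - k"
      then have new: "a \<in> new" "b \<in> new" using lt by (auto simp: new_def)
      then obtain l h where reg: "is_region v l h" "a \<in> {l..<h}"
        using ex_region_containing[of a v] lt letters(4)[of a] by blast
      have "b < h"
      proof (rule ccontr)
        assume "\<not> b < h"
        then have "v $ h \<noteq> 0" "a < h" "h \<le> b" using reg lt by (auto simp: is_region_def)
        then show False using v0[of h] letters(4)[OF lt(2)] new by (cases "h = b") auto
      qed
      then have "a \<in> {l..<h} \<inter> new" "b \<in> {l..<h} \<inter> new" using new reg ab(1) by auto
      moreover have "{l..<h} \<in> all_regions v" using reg(1) unfolding all_regions_def by blast
      ultimately have "a = b" by (intro unique)
      then show False using ab(1) by simp
    qed
    ultimately show "sgn (w $ b) = - sgn (w $ a)"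
      using entries[OF lt(1)] entries[OF lt(2)] ab k by auto
  qed
qed

text \<open>
  For \<open>v \<noteq> 0\<close> with first and last non-zero entry in positions \<open>p\<close> and \<open>q\<close>: the first (last)
  non-zero entry of \<open>w\<close> is \<open>- k\<close> precisely if there is an entry \<open>- k\<close> in the first (last) region.
\<close>

lemma sum_by_outer_entries:
  assumes alt: "nonzeros_alternate w"
    and p: "p < dim_vec v" "v $ p \<noteq> 0" "\<forall>c<p. v $ c = 0"
    and q: "q < dim_vec v" "v $ q \<noteq> 0" "\<forall>c. q < c \<and> c < dim_vec v \<longrightarrow> v $ c = 0"
  shows "2 * vec_sum w = (if {0..<p} \<inter> new = {} then k else - k)
    + (if {Suc q..<dim_vec v} \<inter> new = {} then k else - k)"
proof -
  let ?n = "dim_vec v"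
  define a where "a = (LEAST c. w $ c \<noteq> 0)"
  have "w $ p \<noteq> 0" "w $ q \<noteq> 0" using letters(3) p q by blast+
  have a: "w $ a \<noteq> 0" unfolding a_def by (rule LeastI) (rule \<open>w $ p \<noteq> 0\<close>)
  have "a \<le> p" unfolding a_def by (rule Least_le) (rule \<open>w $ p \<noteq> 0\<close>)
  have before: "\<forall>c<a. w $ c = 0" unfolding a_def using not_less_Least by blast
  obtain b where b: "q \<le> b" "b < ?n" "w $ b \<noteq> 0"
    and after: "\<And>c. b < c \<Longrightarrow> c < ?n \<Longrightarrow> w $ c = 0"
    using obtain_last_nonzero[of q ?n "\<lambda>c. w $ c"] q(1) \<open>w $ q \<noteq> 0\<close> by blast
  have "a \<le> b"
  proof (rule ccontr)
    assume "\<not> a \<le> b"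
    then show False using before b by simp
  qed
  have "vec_sum w = (\<Sum>c\<le>b. w $ c)"
    unfolding vec_sum_def dim using b after by (intro sum.mono_neutral_right) (auto simp: not_le)
  moreover have "2 * (\<Sum>c\<le>b. w $ c) = w $ a + w $ b"
  proof (rule alternating_sum)
    show "sgn (w $ b) = - sgn (w $ a)" if "a < b" "b < ?n" "w $ a \<noteq> 0" "w $ b \<noteq> 0"
      "\<forall>c. a < c \<and> c < b \<longrightarrow> w $ c = 0" for a b
      using that dim by (intro nonzeros_alternateD[OF alt]) auto
  qed (use entries a before \<open>a \<le> b\<close> b in auto)
  moreover have "w $ a = (if {0..<p} \<inter> new = {} then k else - k)"
  proof (cases "a = p")
    case True
    then have "{0..<p} \<inter> new = {}" using before k by (auto simp: new_def)
    then show ?thesis using True letters(1)[OF p(1)] p(2) by simp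
  next
    case False
    then have "a < p" using \<open>a \<le> p\<close> by simp
    then have "a \<in> new" using letters(3)[of a] a p by auto
    then show ?thesis using \<open>a < p\<close> by (auto simp: new_def)
  qed
  moreover have "w $ b = (if {Suc q..<?n} \<inter> new = {} then k else - k)"
  proof (cases "b = q")
    case True
    then have "{Suc q..<?n} \<inter> new = {}" using after k by (auto simp: new_def)
    then show ?thesis using True letters(1)[OF q(1)] q(2) by simp
  next
    case False
    then have "q < b" using b by simp
    then have "b \<in> new" using letters(3)[of b] b q by auto
    moreover have "b \<in> {Suc q..<?n}" using \<open>q < b\<close> b(2) by simp
    ultimately have "{Suc q..<?n} \<inter> new \<noteq> {}" by blast
    then show ?thesis using \<open>b \<in> new\<close> by (simp add: new_def)
  qed
  ultimately show ?thesis by simp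
qed

text \<open>
  By the two preceding lemmas, alternation leaves exactly one entry \<open>- k\<close> in each region between
  two entries \<open>k\<close> and at most one in the first and in the last region; the line sum then says
  whether none, exactly one or both of these two regions contain an entry \<open>- k\<close>. The zero
  line, whose single region is both first and last, is separate.
\<close>

theorem line_completion_iff:
  assumes t: "t \<in> {0, 1, -1}" and nonempty: "0 < dim_vec v"
    and nonzero: "t = k \<Longrightarrow> v \<noteq> 0\<^sub>v (dim_vec v)"
  shows "nonzeros_alternate w \<and> vec_sum w = t \<longleftrightarrow> exact_transversal new (regions_of_type k t v)"
proof (cases "\<exists>c<dim_vec v. v $ c \<noteq> 0")
  case False
  let ?n = "dim_vec v"
  have v0: "v $ c = 0" if "c < ?n" for c using False that by blast
  have reg: "is_region v a b \<longleftrightarrow> a = 0 \<and> b = ?n" for a b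
  proof
    assume r: "is_region v a b"
    have "v $ (a - 1) = 0" if "a \<noteq> 0" using r that nonempty by (intro v0) (auto simp: is_region_def)
    moreover have "v $ b = 0" if "b \<noteq> ?n" using r that by (intro v0) (auto simp: is_region_def)
    ultimately show "a = 0 \<and> b = ?n" using r by (auto simp: is_region_def)
  qed (use v0 in \<open>auto simp: is_region_def\<close>)
  have all: "all_regions v = {{0..<?n}}" and bounded: "bounded_regions k v = {}"
    and outer: "outer_regions v = {}"
    using nonempty by (auto simp: all_regions_def bounded_regions_def outer_regions_def reg)
  have "v = 0\<^sub>v ?n" using v0 by (intro eq_vecI) auto
  then have "t \<noteq> k" using nonzero by blast
  then have cases: "t = 0 \<or> t = - k" "k \<noteq> 0" "k \<noteq> - k" using t k by auto
  have new: "new \<subseteq> {0..<?n}" "finite new" by (auto simp: new_def)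
  have "vec_sum w = (\<Sum>c<?n. if c \<in> new then - k else 0)"
    unfolding vec_sum_def dim using letters(3) v0 by (intro sum.cong) (auto simp: new_def)
  also have "\<dots> = - k * int (card new)"
    using new by (simp add: sum.If_cases lessThan_atLeast0 Int_absorb1)
  finally have sum: "vec_sum w = - k * int (card new)" .
  have alt: "nonzeros_alternate w \<longleftrightarrow> (\<forall>c\<in>new. \<forall>d\<in>new. c = d)"
    using new(1) by (simp add: alternate_iff all bounded Int_absorb1)
  from cases(1) show ?thesis
  proof
    assume "t = 0"
    then have "regions_of_type k t v = {}" using cases by (auto simp: regions_of_type_def bounded outer)
    then show ?thesis
      using \<open>t = 0\<close> sum alt cases new(2) by (auto simp: exact_transversal_def)
  next
    assume t: "t = - k"
    then have "regions_of_type k t v = {{0..<?n}}" using cases by (simp add: regions_of_type_def all)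
    then have "exact_transversal new (regions_of_type k t v) \<longleftrightarrow> (\<exists>!c. c \<in> new)"
      using new(1) by (simp add: exact_transversal_def Int_absorb1 flip: Int_iff)
    also have "\<dots> \<longleftrightarrow> card new = 1"
      by (simp add: card_1_singleton_iff Ex1_def set_eq_iff) blast
    finally show ?thesis using sum alt t cases(2) by (auto simp: card_1_singleton_iff)
  qed
next
  case True
  let ?n = "dim_vec v"
  define p where "p = (LEAST c. c < ?n \<and> v $ c \<noteq> 0)"
  have p: "p < ?n" "v $ p \<noteq> 0"
    using LeastI_ex[OF True[unfolded Bex_def]] unfolding p_def by auto
  have p0: "\<forall>c<p. v $ c = 0"
    unfolding p_def using not_less_Least p(1) by (metis (mono_tags, lifting) order.strict_trans p_def)
  obtain q where q: "p \<le> q" "q < ?n" "v $ q \<noteq> 0" and q0: "\<And>c. q < c \<Longrightarrow> c < ?n \<Longrightarrow> v $ c = 0"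
    using obtain_last_nonzero[of p ?n "\<lambda>c. v $ c"] p by blast
  let ?F = "{0..<p}" and ?L = "{Suc q..<?n}" and ?B = "bounded_regions k v"
  have regF: "is_region v 0 b \<longleftrightarrow> b = p" for b
    using p p0 unfolding is_region_def by (auto, metis linorder_neqE_nat nat_less_le)
  have regL: "is_region v a ?n \<longleftrightarrow> a = Suc q" for a
  proof
    assume a: "is_region v a ?n"
    then have "\<not> a \<le> q" using q by (auto simp: is_region_def)
    moreover have "\<not> Suc q < a"
    proof
      assume "Suc q < a"
      then have "v $ (a - 1) \<noteq> 0" "q < a - 1" "a - 1 < ?n" using a by (auto simp: is_region_def)
      then show False using q0 by blast
    qed
    ultimately show "a = Suc q" by simp
  qed (use q q0 in \<open>auto simp: is_region_def\<close>)
  have all: "all_regions v = insert ?F (insert ?L ?B)"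
  proof
    show "all_regions v \<subseteq> insert ?F (insert ?L ?B)"
    proof
      fix I assume "I \<in> all_regions v"
      then obtain a b where I: "I = {a..<b}" "is_region v a b" by (auto simp: all_regions_def)
      show "I \<in> insert ?F (insert ?L ?B)"
      proof (cases "a = 0 \<or> b = ?n")
        case True
        then have "a = 0 \<and> b = p \<or> a = Suc q \<and> b = ?n" using I(2) regF[of b] regL[of a] by auto
        then show ?thesis using I(1) by auto
      next
        case False
        then have "a - 1 < ?n" "b < ?n" "v $ (a - 1) \<noteq> 0" "v $ b \<noteq> 0"
          using I(2) by (auto simp: is_region_def)
        then have "v $ (a - 1) = k" "v $ b = k" using letters(2) by blast+
        then show ?thesis using I False \<open>b < ?n\<close> by (auto simp: bounded_regions_def)
      qed
    qed
    have "?F \<in> all_regions v" "?L \<in> all_regions v"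
      unfolding all_regions_def using regF[of p] regL[of "Suc q"] by blast+
    then show "insert ?F (insert ?L ?B) \<subseteq> all_regions v" using bounded_regions_subset by blast
  qed
  have FL: "?F \<inter> ?L = {}" using q(1) by auto
  have outer: "outer_regions v = {?F \<union> ?L}"
    unfolding outer_regions_def regF regL using FL by auto
  have disj: "(?F \<union> ?L) \<inter> I = {}" if "I \<in> ?B" for I
    using bounded_outer_disjoint[OF that, of "?F \<union> ?L"] outer by blast
  have cover: "new \<subseteq> ?F \<union> ?L \<union> \<Union>?B" using new_subset_regions unfolding all by auto
  have kk: "k \<noteq> 0" "k \<noteq> - k" using k by auto
  define inner where "inner \<longleftrightarrow> (\<forall>I\<in>?B. \<exists>!c. c \<in> I \<inter> new)"
  define once where "once C \<longleftrightarrow> (\<forall>c\<in>C. \<forall>d\<in>C. c = d)" for C :: "nat set"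
  define noF where "noF \<longleftrightarrow> ?F \<inter> new = {}"
  define noL where "noL \<longleftrightarrow> ?L \<inter> new = {}"
  have ex1: "(\<exists>!c. c \<in> C) \<longleftrightarrow> once C \<and> C \<noteq> {}" for C
    unfolding once_def Ex1_def by blast
  have alt: "nonzeros_alternate w \<longleftrightarrow> inner \<and> once (?F \<inter> new) \<and> once (?L \<inter> new)"
    unfolding alternate_iff all inner_def ex1 by (auto simp: once_def)
  have sum: "vec_sum w = (if noF \<and> noL then k else if noF \<or> noL then 0 else - k)"
    if "nonzeros_alternate w"
    using sum_by_outer_entries[OF that p p0 q(2,3)] q0 unfolding noF_def[symmetric] noL_def[symmetric]
    by (cases noF; cases noL) auto
  have once_Un: "once ((?F \<union> ?L) \<inter> new) \<and> (?F \<union> ?L) \<inter> new \<noteq> {} \<longleftrightarrow>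
      once (?F \<inter> new) \<and> once (?L \<inter> new) \<and> noF \<noteq> noL"
  proof -
    have empty: "once {}" by (simp add: once_def)
    consider "noF" | "\<not> noF" "noL" | "\<not> noF" "\<not> noL" by blast
    then show ?thesis
    proof cases
      case 1
      then have "?F \<inter> new = {}" "(?F \<union> ?L) \<inter> new = ?L \<inter> new" unfolding noF_def by blast+
      then show ?thesis using 1 empty unfolding noL_def by simp
    next
      case 2
      then have "?L \<inter> new = {}" "(?F \<union> ?L) \<inter> new = ?F \<inter> new" unfolding noL_def by blast+
      then show ?thesis using 2 empty unfolding noF_def by simp
    next
      case 3
      then obtain c d where "c \<in> ?F \<inter> new" "d \<in> ?L \<inter> new" unfolding noF_def noL_def by blast
      then have "c \<noteq> d" "c \<in> (?F \<union> ?L) \<inter> new" "d \<in> (?F \<union> ?L) \<inter> new" using q(1) by auto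
      then have "\<not> once ((?F \<union> ?L) \<inter> new)" unfolding once_def by blast
      then show ?thesis using 3 by simp
    qed
  qed
  consider "t = k" | "t = - k" | "t = 0" using t k by auto
  then show ?thesis
  proof cases
    case 1
    then have "exact_transversal new (regions_of_type k t v) \<longleftrightarrow> new \<subseteq> \<Union>?B \<and> inner"
      by (simp add: regions_of_type_def exact_transversal_def inner_def)
    also have "new \<subseteq> \<Union>?B \<longleftrightarrow> noF \<and> noL"
      using cover disj unfolding noF_def noL_def by blast
    also have "(noF \<and> noL) \<and> inner \<longleftrightarrow> nonzeros_alternate w \<and> noF \<and> noL"
      unfolding alt noF_def noL_def by (auto simp: once_def)
    also have "\<dots> \<longleftrightarrow> nonzeros_alternate w \<and> vec_sum w = t"
      using sum 1 kk by (cases noF; cases noL) auto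
    finally show ?thesis by simp
  next
    case 2
    then have "regions_of_type k t v = insert ?F (insert ?L ?B)"
      using kk by (simp add: regions_of_type_def all)
    moreover have "new \<subseteq> \<Union>(insert ?F (insert ?L ?B))" using cover by auto
    ultimately have "exact_transversal new (regions_of_type k t v) \<longleftrightarrow>
        inner \<and> (\<exists>!c. c \<in> ?F \<inter> new) \<and> (\<exists>!c. c \<in> ?L \<inter> new)"
      by (simp only: exact_transversal_def inner_def ball_simps simp_thms conj_ac)
    also have "\<dots> \<longleftrightarrow> nonzeros_alternate w \<and> \<not> noF \<and> \<not> noL"
      unfolding alt ex1 noF_def noL_def by blast
    also have "\<dots> \<longleftrightarrow> nonzeros_alternate w \<and> vec_sum w = t"
      using sum 2 kk by (cases noF; cases noL) auto
    finally show ?thesis by simp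
  next
    case 3
    then have "regions_of_type k t v = insert (?F \<union> ?L) ?B"
      using kk by (simp add: regions_of_type_def outer)
    moreover have "new \<subseteq> \<Union>(insert (?F \<union> ?L) ?B)" using cover by auto
    ultimately have "exact_transversal new (regions_of_type k t v) \<longleftrightarrow>
        inner \<and> (\<exists>!c. c \<in> (?F \<union> ?L) \<inter> new)"
      by (simp only: exact_transversal_def inner_def ball_simps simp_thms conj_ac)
    also have "\<dots> \<longleftrightarrow> nonzeros_alternate w \<and> noF \<noteq> noL"
      unfolding alt ex1 once_Un by blast
    also have "\<dots> \<longleftrightarrow> nonzeros_alternate w \<and> vec_sum w = t"
      using sum 3 kk by (cases noF; cases noL) auto
    finally show ?thesis by simp
  qed
qed

end


section \<open>Completing a matrix\<close>

definition positions :: "int \<Rightarrow> int mat \<Rightarrow> (nat \<times> nat) set" where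
  "positions x A = {(i, j). i < dim_row A \<and> j < dim_col A \<and> A $$ (i, j) = x}"

lemma row_regions_lines:
  assumes "X \<in> carrier_mat n n"
  shows "row_regions k X R = {Pair i ` I | i I. i < n \<and> I \<in> regions_of_type k (R $ i) (row X i)}"
proof -
  have "{i} \<times> I = Pair i ` I" for i :: nat and I :: "nat set" by auto
  then show ?thesis using assms by (simp add: row_regions_def)
qed

lemma col_regions_lines:
  assumes "X \<in> carrier_mat n n"
  shows "col_regions k X S =
    {(\<lambda>i. (i, j)) ` I | j I. j < n \<and> I \<in> regions_of_type k (S $ j) (col X j)}"
proof -
  have "I \<times> {j} = (\<lambda>i. (i, j)) ` I" for j :: nat and I :: "nat set" by auto
  then show ?thesis using assms by (simp add: col_regions_def)
qed

lemma disjoint_row_regions: "X \<in> carrier_mat n n \<Longrightarrow> disjoint (row_regions k X R)"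
  by (simp only: row_regions_lines) (rule disjoint_lines, auto simp: disjoint_regions_of_type)

lemma disjoint_col_regions: "X \<in> carrier_mat n n \<Longrightarrow> disjoint (col_regions k X S)"
  by (simp only: col_regions_lines) (rule disjoint_lines, auto simp: disjoint_regions_of_type)

lemma row_regions_bound:
  assumes "X \<in> carrier_mat n n" "P \<in> row_regions k X R"
  shows "P \<subseteq> {..<n} \<times> {..<n}"
proof -
  obtain i I where "P = {i} \<times> I" "i < n" and I: "I \<in> regions_of_type k (R $ i) (row X i)"
    using assms by (auto simp: row_regions_def)
  then show ?thesis using regions_of_type_bound[OF I] assms(1) by auto
qed

lemma col_regions_bound:
  assumes "X \<in> carrier_mat n n" "Q \<in> col_regions k X S"
  shows "Q \<subseteq> {..<n} \<times> {..<n}"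
proof -
  obtain j I where "Q = I \<times> {j}" "j < n" and I: "I \<in> regions_of_type k (S $ j) (col X j)"
    using assms by (auto simp: col_regions_def)
  then show ?thesis using regions_of_type_bound[OF I] assms(1) by auto
qed

lemma zero_on_region:
  assumes "I \<in> regions_of_type k t v" "c \<in> I"
  shows "v $ c = 0"
  using assms
  by (fastforce simp: regions_of_type_def bounded_regions_def outer_regions_def all_regions_def
      is_region_def split: if_splits)

locale completed_matrix =
  fixes k :: int and n :: nat and X A :: "int mat"
  assumes k: "k \<in> {-1, 1}"
    and A: "A \<in> carrier_mat n n" and A_entries: "elements_mat A \<subseteq> {0, 1, -1}"
    and X: "sign_part k A = X"
begin

lemma X_carrier: "X \<in> carrier_mat n n"
  using A X by (auto simp: sign_part_def)

lemma entry:
  assumes "i < n" "j < n"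
  shows "A $$ (i, j) \<in> {0, 1, -1}" "X $$ (i, j) = (if A $$ (i, j) = - k then 0 else A $$ (i, j))"
proof -
  show "A $$ (i, j) \<in> {0, 1, -1}" using A_entries elements_matI[OF A assms refl] by blast
  show "X $$ (i, j) = (if A $$ (i, j) = - k then 0 else A $$ (i, j))"
    using A assms by (auto simp: sign_part_def simp flip: X)
qed

lemma row_line: "i < n \<Longrightarrow> completed_line k (row X i) (row A i)"
  using k A X_carrier entry by unfold_locales auto

lemma col_line: "j < n \<Longrightarrow> completed_line k (col X j) (col A j)"
  using k A X_carrier entry by unfold_locales auto

lemma row_completion_iff:
  assumes R: "R \<in> carrier_vec n" "set\<^sub>v R \<subseteq> {0, 1, -1}"
    and nonzero: "\<And>i. i < n \<Longrightarrow> R $ i = k \<Longrightarrow> row X i \<noteq> 0\<^sub>v n"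
  shows "(\<forall>i<n. nonzeros_alternate (row A i)) \<and> row_sums A = R \<longleftrightarrow>
    exact_transversal (positions (- k) A) (row_regions k X R)"
proof -
  have "row_sums A = R \<longleftrightarrow> (\<forall>i<n. vec_sum (row A i) = R $ i)"
    using A R by (auto simp: row_sums_def vec_eq_iff)
  moreover have "nonzeros_alternate (row A i) \<and> vec_sum (row A i) = R $ i \<longleftrightarrow>
      exact_transversal {j. (i, j) \<in> positions (- k) A} (regions_of_type k (R $ i) (row X i))"
    if i: "i < n" for i
  proof -
    interpret completed_line k "row X i" "row A i" by (rule row_line[OF i])
    have "{j. (i, j) \<in> positions (- k) A} = new"
      using A X_carrier i by (auto simp: positions_def new_def)
    moreover have "R $ i \<in> {0, 1, -1}" using R i by (auto simp: vec_set_def)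
    ultimately show ?thesis using line_completion_iff[of "R $ i"] nonzero[OF i] X_carrier i by simp
  qed
  moreover have "exact_transversal (positions (- k) A) (row_regions k X R) \<longleftrightarrow>
      (\<forall>i<n. exact_transversal {j. (i, j) \<in> positions (- k) A}
        (regions_of_type k (R $ i) (row X i)))"
    unfolding row_regions_lines[OF X_carrier]
    by (rule exact_transversal_lines) (use A in \<open>auto simp: positions_def\<close>)
  ultimately show ?thesis by blast
qed

lemma col_completion_iff:
  assumes S: "S \<in> carrier_vec n" "set\<^sub>v S \<subseteq> {0, 1, -1}"
    and nonzero: "\<And>j. j < n \<Longrightarrow> S $ j = k \<Longrightarrow> col X j \<noteq> 0\<^sub>v n"
  shows "(\<forall>j<n. nonzeros_alternate (col A j)) \<and> col_sums A = S \<longleftrightarrow>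
    exact_transversal (positions (- k) A) (col_regions k X S)"
proof -
  have "col_sums A = S \<longleftrightarrow> (\<forall>j<n. vec_sum (col A j) = S $ j)"
    using A S by (auto simp: col_sums_def vec_eq_iff)
  moreover have "nonzeros_alternate (col A j) \<and> vec_sum (col A j) = S $ j \<longleftrightarrow>
      exact_transversal {i. (i, j) \<in> positions (- k) A} (regions_of_type k (S $ j) (col X j))"
    if j: "j < n" for j
  proof -
    interpret completed_line k "col X j" "col A j" by (rule col_line[OF j])
    have "{i. (i, j) \<in> positions (- k) A} = new"
      using A X_carrier j by (auto simp: positions_def new_def)
    moreover have "S $ j \<in> {0, 1, -1}" using S j by (auto simp: vec_set_def)
    ultimately show ?thesis using line_completion_iff[of "S $ j"] nonzero[OF j] X_carrier j by simp
  qed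
  moreover have "exact_transversal (positions (- k) A) (col_regions k X S) \<longleftrightarrow>
      (\<forall>j<n. exact_transversal {i. (i, j) \<in> positions (- k) A}
        (regions_of_type k (S $ j) (col X j)))"
    unfolding col_regions_lines[OF X_carrier]
    by (rule exact_transversal_lines) (use A in \<open>auto simp: positions_def\<close>)
  ultimately show ?thesis by blast
qed

end

text \<open>Writing \<open>- k\<close> into positions where \<open>X\<close> is zero inverts \<open>sign_part\<close>.\<close>

lemma ex_completed_matrix:
  assumes k: "k \<in> {-1, 1}" and X: "X \<in> carrier_mat n n" "elements_mat X \<subseteq> {0, k}"
    and N: "N \<subseteq> {..<n} \<times> {..<n}" "\<And>x. x \<in> N \<Longrightarrow> X $$ x = 0"
  obtains A where "completed_matrix k n X A" "positions (- k) A = N"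
proof -
  define A where "A = mat n n (\<lambda>x. if x \<in> N then - k else X $$ x)"
  have entry: "X $$ (i, j) \<in> {0, k}" if "i < n" "j < n" for i j
    using X(2) elements_matI[OF X(1) that refl] by blast
  have kk: "k \<noteq> - k" "- k \<noteq> 0" using k by auto
  have "completed_matrix k n X A"
  proof
    show "elements_mat A \<subseteq> {0, 1, -1}"
      using entry k by (fastforce simp: A_def elements_mat_def split: if_splits)
    show "sign_part k A = X"
      using entry X(1) N(2) kk by (intro eq_matI) (fastforce simp: A_def sign_part_def)+
  qed (use k in \<open>auto simp: A_def\<close>)
  moreover have "positions (- k) A = N"
    using entry N(1) kk by (fastforce simp: A_def positions_def split: if_splits)
  ultimately show ?thesis by (rule that)
qed

theorem corollary4p6:
  fixes k :: int and n m :: nat and X :: "int mat" and R S :: "int vec"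
  assumes "k \<in> {-1, 1}"
    and "X \<in> carrier_mat n n" and "elements_mat X \<subseteq> {0, k}"
    and "R \<in> carrier_vec n" and "set\<^sub>v R \<subseteq> {0, 1, -1}"
    and "S \<in> carrier_vec n" and "set\<^sub>v S \<subseteq> {0, 1, -1}"
    and "\<And>i. i < n \<Longrightarrow> R $ i = k \<Longrightarrow> row X i \<noteq> 0\<^sub>v n"
    and "\<And>j. j < n \<Longrightarrow> S $ j = k \<Longrightarrow> col X j \<noteq> 0\<^sub>v n"
    and "{} \<notin> row_regions k X R" and "{} \<notin> col_regions k X S"
    and "vec_sum R = vec_sum S"
    and "card (row_regions k X R) = m" and "card (col_regions k X S) = m"
  shows "(\<exists>A \<in> weak_asm n. row_sums A = R \<and> col_sums A = S \<and> sign_part k A = X) \<longleftrightarrow>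
    \<not> (\<exists>P Q r s. P \<subseteq> row_regions k X R \<and> Q \<subseteq> col_regions k X S \<and>
         card P = r \<and> card Q = s \<and> r + s = m + 1 \<and> non_overlapping P Q)"
proof -
  let ?\<R> = "row_regions k X R" and ?\<S> = "col_regions k X S"
  have "(\<exists>A \<in> weak_asm n. row_sums A = R \<and> col_sums A = S \<and> sign_part k A = X) \<longleftrightarrow>
    (\<exists>N. exact_transversal N ?\<R> \<and> exact_transversal N ?\<S>)"
  proof
    assume "\<exists>A \<in> weak_asm n. row_sums A = R \<and> col_sums A = S \<and> sign_part k A = X"
    then obtain A where wA: "A \<in> weak_asm n" "row_sums A = R" "col_sums A = S" "sign_part k A = X"
      by blast
    interpret completed_matrix k n X A
      using wA assms(1) by unfold_locales (auto simp: weak_asm_def)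
    have alt: "\<forall>i<n. nonzeros_alternate (row A i)" "\<forall>j<n. nonzeros_alternate (col A j)"
      using wA(1) by (auto simp: weak_asm_def)
    have "exact_transversal (positions (- k) A) ?\<R>"
      using row_completion_iff[OF assms(4,5,8)] alt(1) wA(2) by simp
    moreover have "exact_transversal (positions (- k) A) ?\<S>"
      using col_completion_iff[OF assms(6,7,9)] alt(2) wA(3) by simp
    ultimately show "\<exists>N. exact_transversal N ?\<R> \<and> exact_transversal N ?\<S>" by blast
  next
    assume "\<exists>N. exact_transversal N ?\<R> \<and> exact_transversal N ?\<S>"
    then obtain N where N: "exact_transversal N ?\<R>" "exact_transversal N ?\<S>" by blast
    have "N \<subseteq> \<Union>?\<R>" using N(1) by (simp add: exact_transversal_def)
    then have bound: "N \<subseteq> {..<n} \<times> {..<n}" using row_regions_bound[OF assms(2)] by blast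
    have zero: "X $$ x = 0" if "x \<in> N" for x
    proof -
      obtain P where "P \<in> ?\<R>" "x \<in> P" using \<open>N \<subseteq> \<Union>?\<R>\<close> \<open>x \<in> N\<close> by blast
      then obtain i j I where x: "x = (i, j)" "i < n" "j < n"
          and I: "I \<in> regions_of_type k (R $ i) (row X i)" "j \<in> I"
        using row_regions_bound[OF assms(2), of P k R] assms(2) by (auto simp: row_regions_def)
      then show ?thesis using zero_on_region[OF I] x assms(2) by simp
    qed
    obtain A where cm: "completed_matrix k n X A" and pos: "positions (- k) A = N"
      using ex_completed_matrix[OF assms(1-3) bound zero] by blast
    interpret completed_matrix k n X A by (rule cm)
    have rows: "\<forall>i<n. nonzeros_alternate (row A i)" "row_sums A = R"
      using row_completion_iff[OF assms(4,5,8)] N(1) pos by auto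
    have cols: "\<forall>j<n. nonzeros_alternate (col A j)" "col_sums A = S"
      using col_completion_iff[OF assms(6,7,9)] N(2) pos by auto
    have "vec_sum (row A i) \<in> {0, 1, -1}" if "i < n" for i
    proof -
      have "vec_sum (row A i) = R $ i" using rows(2) A that by (auto simp: row_sums_def)
      then show ?thesis using assms(4,5) that by (auto simp: vec_set_def)
    qed
    moreover have "vec_sum (col A j) \<in> {0, 1, -1}" if "j < n" for j
    proof -
      have "vec_sum (col A j) = S $ j" using cols(2) A that by (auto simp: col_sums_def)
      then show ?thesis using assms(6,7) that by (auto simp: vec_set_def)
    qed
    ultimately have "A \<in> weak_asm n" using A A_entries rows(1) cols(1) by (simp add: weak_asm_def)
    then show "\<exists>A \<in> weak_asm n. row_sums A = R \<and> col_sums A = S \<and> sign_part k A = X"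
      using rows cols X by blast
  qed
  also have "\<dots> \<longleftrightarrow> \<not> (\<exists>P Q. P \<subseteq> ?\<R> \<and> Q \<subseteq> ?\<S> \<and> card P + card Q = m + 1 \<and>
      (\<forall>p\<in>P. \<forall>q\<in>Q. p \<inter> q = {}))"
  proof (rule ex_common_exact_transversal_iff)
    have "?\<R> \<subseteq> Pow ({..<n} \<times> {..<n})" "?\<S> \<subseteq> Pow ({..<n} \<times> {..<n})"
      using row_regions_bound[OF assms(2)] col_regions_bound[OF assms(2)] by blast+
    then show "finite ?\<R>" "finite ?\<S>" by (auto elim: finite_subset)
  qed (use assms disjoint_row_regions disjoint_col_regions in auto)
  finally show ?thesis by (simp add: non_overlapping_def)
qed

end
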